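(* For every $n$ there exists an instance of the independent action sequential contract problem with $n$ actions and $m=3$ outcomes for which the ratio between the optimal principal's utility over general contracts and the optimal principal's utility over linear contracts, $$\frac{\sup_{t:[3]\to\mathbb{R}_{\ge0}}u_P(t)}{\sup_{\alpha\in[0,1]}u_P(t_\alpha)},$$ is $\Omega(n)$ (i.e. at least $C\cdot n$ for an absolute constant $C>0$).
   Context: Sequential contract problem. An instance consists of a set $A$ of $n$ actions with costs $c_i\ge 0$ ($i\in A$), a set $[m]=\{1,\dots,m\}$ of outcomes with principal rewards $0=r(1)\le r(2)\le\dots\le r(m)$, and random variables $X_i$ with values in $[m]$ ($i\in A$), where $X_i$ is the outcome of action $i$. In the independent action model the $X_i$ are independent and $p_{ij}=\Pr[X_i=j]$. A contract is a function $t:[m]\to\mathbb{R}_{\ge 0}$. Given $t$, the agent acts sequentially: at each point he either takes a not-yet-taken action $i$, pays $c_i$ and observes the realization of $X_i$, or halts. On halting he selects one revealed outcome as the final outcome; outcome $1$ (the zero outcome) is always considered revealed. A (deterministic) strategy $\pi$ specifies all these decisions as a function of the history; there are finitely many strategies. $S(\pi)$ is the random set of actions taken, $\omega(\pi)$ the random final outcome. Utilities: $u_A(t,\pi)=\mathbb{E}[t(\omega(\pi))-\sum_{i\in S(\pi)}c_i]$ and $u_P(t,\pi)=\mathbb{E}[r(\omega(\pi))-t(\omega(\pi))]$. The best response $\pi^\star(t)$ is a strategy maximizing $u_A(t,\cdot)$, with ties broken in favour of larger $u_P(t,\cdot)$ and remaining ties broken consistently by a fixed total order on strategies. $u_P(t)=u_P(t,\pi^\star(t))$.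 A linear contract with parameter $\alpha\in[0,1]$ is $t_\alpha(j)=\alpha\cdot r(j)$. *)

theory Defs
  imports "HOL-Probability.Probability"
begin

text \<open>
  An instance with action set \<open>actions I\<close> and outcomes \<open>{1..num_outcomes I}\<close>.  The random variable
  \<open>X\<^sub>i\<close> is the coordinate function \<open>\<lambda>x. x i\<close> on the profiles \<open>x\<close> drawn from \<open>profile_dist I\<close>;
  coordinates outside \<open>actions I\<close> play no role.
\<close>

record 'a contract_instance =
  actions :: "'a set"
  num_outcomes :: nat
  cost :: "'a \<Rightarrow> real"
  reward :: "nat \<Rightarrow> real"
  profile_dist :: "('a \<Rightarrow> nat) pmf"

definition outcomes :: "'a contract_instance \<Rightarrow> nat set" where
  "outcomes I = {1..num_outcomes I}"

definition valid_instance :: "'a contract_instance \<Rightarrow> bool" where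
  "valid_instance I \<longleftrightarrow>
     finite (actions I) \<and>
     1 \<le> num_outcomes I \<and>
     (\<forall>i\<in>actions I. 0 \<le> cost I i) \<and>
     reward I 1 = 0 \<and>
     mono_on (outcomes I) (reward I) \<and>
     (\<forall>x\<in>set_pmf (profile_dist I). \<forall>i\<in>actions I. x i \<in> outcomes I)"

definition independent_actions :: "'a contract_instance \<Rightarrow> bool" where
  "independent_actions I \<longleftrightarrow>
     prob_space.indep_vars (measure_pmf (profile_dist I))
       (\<lambda>_. count_space UNIV) (\<lambda>i x. x i) (actions I)"

text \<open>
  A history lists the actions taken so far, in order, each with its observed outcome.  A strategy
  assigns a permitted decision to every conceivable history (including those it never reaches
  itself); \<open>Halt j\<close> halts and selects \<open>j\<close> as the final outcome.
\<close>

type_synonym 'a history = "('a \<times> nat) list"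

datatype 'a decision = Take 'a | Halt nat

type_synonym 'a strategy = "'a history \<Rightarrow> 'a decision"

definition histories :: "'a contract_instance \<Rightarrow> 'a history set" where
  "histories I = {h. set h \<subseteq> actions I \<times> outcomes I \<and> distinct (map fst h)}"

definition decisions :: "'a contract_instance \<Rightarrow> 'a history \<Rightarrow> 'a decision set" where
  "decisions I h = Take ` (actions I - fst ` set h) \<union> Halt ` insert 1 (snd ` set h)"

definition strategies :: "'a contract_instance \<Rightarrow> 'a strategy set" where
  "strategies I = (\<Pi>\<^sub>E h\<in>histories I. decisions I h)"

definition step :: "'a strategy \<Rightarrow> ('a \<Rightarrow> nat) \<Rightarrow> 'a history \<Rightarrow> 'a history" where
  "step \<pi> x h = (case \<pi> h of Take i \<Rightarrow> h @ [(i, x i)] | Halt j \<Rightarrow> h)"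

text \<open>
  Every non-halting step takes a new action, so \<open>card (actions I)\<close> steps always lead to a history
  at which the strategy halts (shown below as \<open>final_history_halts\<close>).
\<close>

definition final_history ::
  "'a contract_instance \<Rightarrow> 'a strategy \<Rightarrow> ('a \<Rightarrow> nat) \<Rightarrow> 'a history" where
  "final_history I \<pi> x = (step \<pi> x ^^ card (actions I)) []"

definition actions_taken ::
  "'a contract_instance \<Rightarrow> 'a strategy \<Rightarrow> ('a \<Rightarrow> nat) \<Rightarrow> 'a set" where
  "actions_taken I \<pi> x = fst ` set (final_history I \<pi> x)"

definition final_outcome ::
  "'a contract_instance \<Rightarrow> 'a strategy \<Rightarrow> ('a \<Rightarrow> nat) \<Rightarrow> nat" where
  "final_outcome I \<pi> x = (THE j. \<pi> (final_history I \<pi> x) = Halt j)"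

definition agent_utility ::
  "'a contract_instance \<Rightarrow> (nat \<Rightarrow> real) \<Rightarrow> 'a strategy \<Rightarrow> real" where
  "agent_utility I t \<pi> = measure_pmf.expectation (profile_dist I)
     (\<lambda>x. t (final_outcome I \<pi> x) - (\<Sum>i\<in>actions_taken I \<pi> x. cost I i))"

definition principal_utility ::
  "'a contract_instance \<Rightarrow> (nat \<Rightarrow> real) \<Rightarrow> 'a strategy \<Rightarrow> real" where
  "principal_utility I t \<pi> = measure_pmf.expectation (profile_dist I)
     (\<lambda>x. reward I (final_outcome I \<pi> x) - t (final_outcome I \<pi> x))"

definition agent_optimal ::
  "'a contract_instance \<Rightarrow> (nat \<Rightarrow> real) \<Rightarrow> 'a strategy set" where
  "agent_optimal I t = {\<pi>. is_arg_max (agent_utility I t) (\<lambda>\<pi>. \<pi> \<in> strategies I) \<pi>}"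

definition principal_preferred ::
  "'a contract_instance \<Rightarrow> (nat \<Rightarrow> real) \<Rightarrow> 'a strategy set" where
  "principal_preferred I t =
     {\<pi>. is_arg_max (principal_utility I t) (\<lambda>\<pi>. \<pi> \<in> agent_optimal I t) \<pi>}"

text \<open>
  \<open>R\<close> is the total order on \<open>strategies I\<close> that breaks the remaining ties.
\<close>

definition best_response ::
  "'a contract_instance \<Rightarrow> 'a strategy rel \<Rightarrow> (nat \<Rightarrow> real) \<Rightarrow> 'a strategy" where
  "best_response I R t =
     (THE \<pi>. \<pi> \<in> principal_preferred I t \<and> (\<forall>\<pi>'\<in>principal_preferred I t. (\<pi>, \<pi>') \<in> R))"

definition principal_value ::
  "'a contract_instance \<Rightarrow> 'a strategy rel \<Rightarrow> (nat \<Rightarrow> real) \<Rightarrow> real" where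
  "principal_value I R t = principal_utility I t (best_response I R t)"

definition contracts :: "'a contract_instance \<Rightarrow> (nat \<Rightarrow> real) set" where
  "contracts I = outcomes I \<rightarrow> {0..}"

definition linear_contract :: "'a contract_instance \<Rightarrow> real \<Rightarrow> nat \<Rightarrow> real" where
  "linear_contract I \<alpha> = (\<lambda>j. \<alpha> * reward I j)"

lemma final_history_halts:
  assumes I: "valid_instance I" and \<pi>: "\<pi> \<in> strategies I" and x: "x \<in> set_pmf (profile_dist I)"
  shows "final_history I \<pi> x \<in> histories I"
    and "\<pi> (final_history I \<pi> x) = Halt (final_outcome I \<pi> x)"
    and "final_outcome I \<pi> x \<in> insert 1 (snd ` set (final_history I \<pi> x))"
    and "final_outcome I \<pi> x \<in> outcomes I"
proof -
  have fin: "finite (actions I)" and one: "1 \<in> outcomes I"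
    and out: "\<And>i. i \<in> actions I \<Longrightarrow> x i \<in> outcomes I"
    using I x by (auto simp: valid_instance_def outcomes_def)
  have dec: "\<pi> h \<in> decisions I h" if "h \<in> histories I" for h
    using \<pi> that by (auto simp: strategies_def)
  define H where "H k = (step \<pi> x ^^ k) []" for k
  have inv: "H k \<in> histories I \<and> ((\<exists>j. \<pi> (H k) = Halt j) \<or> length (H k) = k)" for k
  proof (induction k)
    case 0
    then show ?case by (simp add: H_def histories_def)
  next
    case (Suc k)
    have S: "H (Suc k) = step \<pi> x (H k)" by (simp add: H_def)
    show ?case
    proof (cases "\<pi> (H k)")
      case (Take i)
      then have "i \<in> actions I - fst ` set (H k)"
        using dec[of "H k"] Suc by (auto simp: decisions_def)
      with Suc Take out[of i] show ?thesis
        by (auto simp: S step_def histories_def)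
    next
      case (Halt j)
      with Suc show ?thesis by (auto simp: S step_def)
    qed
  qed
  let ?h = "final_history I \<pi> x"
  have h: "?h \<in> histories I" and halt: "(\<exists>j. \<pi> ?h = Halt j) \<or> length ?h = card (actions I)"
    using inv[of "card (actions I)"] by (auto simp: H_def final_history_def)
  have "\<exists>j. \<pi> ?h = Halt j"
  proof (rule disjE[OF halt])
    assume len: "length ?h = card (actions I)"
    have "fst ` set ?h \<subseteq> actions I" using h by (auto simp: histories_def)
    moreover have "card (fst ` set ?h) = card (actions I)"
      using h len distinct_card[of "map fst ?h"] by (auto simp: histories_def)
    ultimately have "fst ` set ?h = actions I"
      using fin by (simp add: card_subset_eq)
    then show ?thesis using dec[OF h] by (auto simp: decisions_def)
  qed
  then obtain j where j: "\<pi> ?h = Halt j" by blast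
  then have fo: "final_outcome I \<pi> x = j" by (simp add: final_outcome_def)
  show "?h \<in> histories I" by (rule h)
  show "\<pi> ?h = Halt (final_outcome I \<pi> x)" using j fo by simp
  show rev: "final_outcome I \<pi> x \<in> insert 1 (snd ` set ?h)"
    using dec[OF h] j fo by (auto simp: decisions_def)
  show "final_outcome I \<pi> x \<in> outcomes I"
    using rev h one by (auto simp: histories_def)
qed

lemma finite_strategies:
  assumes "valid_instance I"
  shows "finite (strategies I)"
proof -
  have A: "finite (actions I)" and B: "finite (actions I \<times> outcomes I)"
    using assms by (auto simp: valid_instance_def outcomes_def)
  have "histories I \<subseteq> {h. set h \<subseteq> actions I \<times> outcomes I \<and> length h \<le> card (actions I)}"
  proof safe
    fix h assume h: "h \<in> histories I"
    then have "fst ` set h \<subseteq> actions I" "length h = card (fst ` set h)"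
      using distinct_card[of "map fst h"] by (auto simp: histories_def)
    then show "length h \<le> card (actions I)" using A by (simp add: card_mono)
  qed (auto simp: histories_def)
  then have "finite (histories I)"
    using finite_lists_length_le[OF B] finite_subset by blast
  then show ?thesis
    unfolding strategies_def using A by (auto intro!: finite_PiE simp: decisions_def)
qed

lemma strategies_nonempty: "strategies I \<noteq> {}"
proof -
  have "restrict (\<lambda>_. Halt 1) (histories I) \<in> strategies I"
    by (auto simp: strategies_def decisions_def)
  then show ?thesis by blast
qed

lemma best_response_in:
  assumes I: "valid_instance I" and R: "linear_order_on (strategies I) R"
  shows "best_response I R t \<in> principal_preferred I t"
    and "best_response I R t \<in> strategies I"
proof -
  have arg: "\<exists>\<pi>. is_arg_max f (\<lambda>\<pi>. \<pi> \<in> S) \<pi>"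
    if "finite S" "S \<noteq> {}" for S and f :: "'a strategy \<Rightarrow> real"
    using ex_is_arg_min_if_finite[OF that, of "\<lambda>\<pi>. - f \<pi>"]
    by (auto simp: is_arg_min_def is_arg_max_def)
  let ?P = "principal_preferred I t"
  have sub: "agent_optimal I t \<subseteq> strategies I" "?P \<subseteq> agent_optimal I t"
    by (auto simp: agent_optimal_def principal_preferred_def is_arg_max_def)
  have "agent_optimal I t \<noteq> {}"
    using arg[OF finite_strategies[OF I] strategies_nonempty] by (auto simp: agent_optimal_def)
  then have ne: "?P \<noteq> {}"
    using arg[of "agent_optimal I t"] finite_subset[OF sub(1) finite_strategies[OF I]]
    by (auto simp: principal_preferred_def)
  have fin: "finite ?P" using sub finite_strategies[OF I] by (meson finite_subset)
  have PS: "?P \<subseteq> strategies I" using sub by blast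
  have R': "refl_on (strategies I) R" "trans R" "antisym R" "total_on (strategies I) R"
    using R by (auto simp: order_on_defs)
  have least: "\<exists>a\<in>Q. \<forall>b\<in>Q. (a, b) \<in> R" if "finite Q" "Q \<noteq> {}" "Q \<subseteq> strategies I" for Q
    using that
  proof (induction rule: finite_ne_induct)
    case (singleton q)
    then show ?case using R'(1) by (auto simp: refl_on_def)
  next
    case (insert q F)
    then obtain a where a: "a \<in> F" "\<forall>b\<in>F. (a, b) \<in> R" by auto
    have qq: "(q, q) \<in> R" using insert R'(1) by (auto simp: refl_on_def)
    have "q \<in> strategies I" "a \<in> strategies I" using insert.prems a(1) by auto
    then have "(a, q) \<in> R \<or> (q, a) \<in> R"
      using R'(4)[unfolded total_on_def, rule_format, of a q] qq by (cases "a = q") simp_all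
    then show ?case
    proof
      assume "(a, q) \<in> R"
      then show ?thesis using a by (intro bexI[of _ a]) simp_all
    next
      assume qa: "(q, a) \<in> R"
      have "(q, b) \<in> R" if "b \<in> F" for b
        using transD[OF R'(2) qa] a(2) that by simp
      then show ?thesis using qq by (intro bexI[of _ q]) simp_all
    qed
  qed
  obtain \<pi>0 where p: "\<pi>0 \<in> ?P" "\<forall>\<pi>'\<in>?P. (\<pi>0, \<pi>') \<in> R"
    using least[OF fin ne PS] by (elim bexE)
  have "\<exists>!\<pi>. \<pi> \<in> ?P \<and> (\<forall>\<pi>'\<in>?P. (\<pi>, \<pi>') \<in> R)"
    using p antisymD[OF R'(3)] by (intro ex1I[of _ \<pi>0]) simp_all
  from theI'[OF this] show *: "best_response I R t \<in> ?P"
    by (simp add: best_response_def)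
  then show "best_response I R t \<in> strategies I" using PS by blast
qed

lemma principal_value_le:
  assumes I: "valid_instance I" and R: "linear_order_on (strategies I) R"
    and t: "t \<in> contracts I"
  shows "principal_value I R t \<le> reward I (num_outcomes I)"
proof -
  define \<pi> where "\<pi> = best_response I R t"
  have \<pi>: "\<pi> \<in> strategies I" using best_response_in(2)[OF I R] by (simp add: \<pi>_def)
  let ?f = "\<lambda>x. reward I (final_outcome I \<pi> x) - t (final_outcome I \<pi> x)"
  have m: "num_outcomes I \<in> outcomes I" "mono_on (outcomes I) (reward I)"
    using I by (auto simp: valid_instance_def outcomes_def)
  have le: "?f x \<le> reward I (num_outcomes I)" if "x \<in> set_pmf (profile_dist I)" for x
  proof -
    have o: "final_outcome I \<pi> x \<in> outcomes I" by (rule final_history_halts(4)[OF I \<pi> that])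
    then have "reward I (final_outcome I \<pi> x) \<le> reward I (num_outcomes I)"
      using m by (intro mono_onD[OF m(2)]) (auto simp: outcomes_def)
    moreover have "0 \<le> t (final_outcome I \<pi> x)" using o t by (auto simp: contracts_def)
    ultimately show ?thesis by simp
  qed
  have fo: "finite (outcomes I)" by (simp add: outcomes_def)
  have "integrable (measure_pmf (profile_dist I)) ?f"
  proof (rule measure_pmf.integrable_const_bound)
    show "AE x in measure_pmf (profile_dist I). norm (?f x) \<le> (\<Sum>j\<in>outcomes I. \<bar>reward I j - t j\<bar>)"
    proof (rule AE_pmfI)
      fix x assume "x \<in> set_pmf (profile_dist I)"
      from final_history_halts(4)[OF I \<pi> this]
      show "norm (?f x) \<le> (\<Sum>j\<in>outcomes I. \<bar>reward I j - t j\<bar>)"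
        using member_le_sum[of "final_outcome I \<pi> x" "outcomes I" "\<lambda>j. \<bar>reward I j - t j\<bar>"] fo
        by auto
    qed
  qed simp
  then have "principal_utility I t \<pi> \<le> reward I (num_outcomes I)"
    unfolding principal_utility_def
    by (intro measure_pmf.integral_le_const) (auto intro: AE_pmfI le)
  then show ?thesis by (simp add: principal_value_def \<pi>_def)
qed

end

theory Submission
  imports Defs
begin

text \<open>
  Action \<open>i\<close> yields outcome 2 with probability \<open>e\<close>, outcome 3 with probability \<open>e (2\<^sup>i - 1)\<close>, and
  costs \<open>e (2\<^sup>i - 1)\<close>; both outcomes have reward 1, and \<open>e\<close> is so small that collisions of
  successes are negligible.  Paying 1 for outcome 3 and nothing for outcome 2 makes the agent
  exactly indifferent, so he may search through all actions, and the principal keeps the reward of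
  outcome 2, about \<open>n e\<close> in expectation.  A linear contract \<open>\<alpha>\<close> gives action \<open>i\<close> the gain
  \<open>g\<^sub>i = e - (1 - \<alpha>) e 2\<^sup>i\<close> for the agent and \<open>(1 - \<alpha>) e 2\<^sup>i\<close> for the principal, so that
  only actions with \<open>(1 - \<alpha>) 2\<^sup>i\<close> of order at most 1 matter, and these contribute a geometric
  sum of order \<open>e\<close>.  This is made robust against the agent's exact strategy by bounding his utility
  by \<open>\<Sum>\<^sub>i y\<^sub>i g\<^sub>i\<close>, with \<open>y\<^sub>i\<close> the probability of taking \<open>i\<close>, and from below by
  that of a threshold search, which is almost \<open>\<Sum>\<^sub>i max 0 g\<^sub>i\<close>.
\<close>

section \<open>Independence of one coordinate under a product distribution\<close>

lemma expectation_pair_pmf_mult: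
  fixes f :: "'a \<Rightarrow> real" and g :: "'b \<Rightarrow> real"
  assumes "finite (set_pmf p)" "finite (set_pmf q)"
  shows "measure_pmf.expectation (pair_pmf p q) (\<lambda>(y, z). f y * g z) =
           measure_pmf.expectation p f * measure_pmf.expectation q g"
proof -
  have "measure_pmf.expectation (pair_pmf p q) (\<lambda>(y, z). f y * g z) =
          (\<Sum>(y, z)\<in>set_pmf p \<times> set_pmf q. (f y * pmf p y) * (g z * pmf q z))"
    using assms
    by (subst integral_measure_pmf_real[of "set_pmf p \<times> set_pmf q"])
       (auto simp: pmf_pair mult_ac intro!: sum.cong)
  also have "\<dots> = (\<Sum>y\<in>set_pmf p. f y * pmf p y) * (\<Sum>z\<in>set_pmf q. g z * pmf q z)"
    by (simp add: sum_product sum.cartesian_product)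
  also have "(\<Sum>y\<in>set_pmf p. f y * pmf p y) = measure_pmf.expectation p f"
    using assms by (subst integral_measure_pmf_real[of "set_pmf p"]) auto
  also have "(\<Sum>z\<in>set_pmf q. g z * pmf q z) = measure_pmf.expectation q g"
    using assms by (subst integral_measure_pmf_real[of "set_pmf q"]) auto
  finally show ?thesis .
qed

lemma finite_set_Pi_pmf:
  assumes "finite A" "\<And>i. i \<in> A \<Longrightarrow> finite (set_pmf (p i))"
  shows "finite (set_pmf (Pi_pmf A d p))"
  using assms by (simp add: set_Pi_pmf finite_PiE_dflt)

text \<open>\<open>Pi_pmf\<close> splits into coordinate \<open>i\<close> and the remaining
  coordinates, and \<open>g\<close> sees only the latter. That \<open>g\<close> ignores coordinate
  \<open>i\<close> is phrased through updates because this is the form in which it can be verified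
  for a run of a strategy.\<close>

lemma expectation_Pi_pmf_mult_component:
  fixes f :: "'b \<Rightarrow> real" and g :: "('a \<Rightarrow> 'b) \<Rightarrow> real"
  assumes A: "finite A" "i \<in> A" and fin: "\<And>j. j \<in> A \<Longrightarrow> finite (set_pmf (p j))"
    and g: "\<And>x v. g (x(i := v)) = g x"
  shows "measure_pmf.expectation (Pi_pmf A d p) (\<lambda>x. f (x i) * g x) =
           measure_pmf.expectation (p i) f * measure_pmf.expectation (Pi_pmf A d p) g"
proof -
  let ?B = "A - {i}"
  have *: "Pi_pmf A d p = map_pmf (\<lambda>(y, z). z(i := y)) (pair_pmf (p i) (Pi_pmf ?B d p))"
    using Pi_pmf_insert[of ?B i d p] A by (simp add: insert_absorb)
  have fin': "finite (set_pmf (p i))" "finite (set_pmf (Pi_pmf ?B d p))"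
    using A fin by (auto intro!: finite_set_Pi_pmf)
  have "measure_pmf.expectation (Pi_pmf A d p) (\<lambda>x. f (x i) * g x) =
          measure_pmf.expectation (p i) f * measure_pmf.expectation (Pi_pmf ?B d p) g"
    unfolding * by (simp add: case_prod_unfold g flip: expectation_pair_pmf_mult[OF fin'])
  moreover have "measure_pmf.expectation (Pi_pmf A d p) g =
                   measure_pmf.expectation (Pi_pmf ?B d p) g"
    unfolding * by (simp add: case_prod_unfold g)
  ultimately show ?thesis by simp
qed

section \<open>How a run depends on the outcome profile\<close>

text \<open>Only a step that takes \<open>i\<close> reads \<open>x i\<close>, and histories only
  grow. If \<open>i\<close> is absent at the end, no earlier step took it, so the two runs agree
  throughout.\<close>

lemma step_funpow_update:
  assumes "i \<notin> fst ` set ((step \<pi> x ^^ k) [])"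
  shows "(step \<pi> (x(i := v)) ^^ k) [] = (step \<pi> x ^^ k) []"
  using assms
proof (induction k)
  case (Suc k)
  let ?h = "(step \<pi> x ^^ k) []"
  have "i \<notin> fst ` set (step \<pi> x ?h)" using Suc.prems by simp
  then have i: "i \<notin> fst ` set ?h" "\<pi> ?h \<noteq> Take i"
    by (auto simp: step_def split: decision.splits)
  have "step \<pi> (x(i := v)) ?h = step \<pi> x ?h"
    using i(2) unfolding step_def[of _ _ ?h] by (cases "\<pi> ?h") auto
  then show ?case by (simp only: funpow.simps comp_apply Suc.IH[OF i(1)])
qed simp

text \<open>Whether \<open>i\<close> is taken is settled before \<open>x i\<close> is observed. One
  direction suffices, since updating \<open>x(i := v)\<close> back to \<open>x i\<close> restores
  \<open>x\<close>.\<close>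

lemma actions_taken_update:
  "i \<in> actions_taken I \<pi> (x(i := v)) \<longleftrightarrow> i \<in> actions_taken I \<pi> x"
proof -
  have *: "i \<notin> actions_taken I \<pi> (z(i := w))" if "i \<notin> actions_taken I \<pi> z" for z w
    using that step_funpow_update[of i "card (actions I)" \<pi> z w]
    by (simp add: actions_taken_def final_history_def)
  show ?thesis using *[of x v] *[of "x(i := v)" "x i"] by auto
qed

lemma step_funpow_outcome:
  "(i, j) \<in> set ((step \<pi> x ^^ k) []) \<Longrightarrow> j = x i"
  by (induction k) (auto simp: step_def split: decision.splits)

lemma final_history_outcome:
  "(i, j) \<in> set (final_history I \<pi> x) \<Longrightarrow> j = x i"
  unfolding final_history_def by (rule step_funpow_outcome)

section \<open>Instances with independent actions: bounds by the probabilities of taking each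
  action\<close>

locale product_instance =
  fixes I :: "'a contract_instance" and d :: nat and p :: "'a \<Rightarrow> nat pmf"
  assumes valid: "valid_instance I"
    and profile: "profile_dist I = Pi_pmf (actions I) d p"
    and fin_p: "\<And>i. i \<in> actions I \<Longrightarrow> finite (set_pmf (p i))"
begin

lemma fin_actions: "finite (actions I)"
  using valid by (simp add: valid_instance_def)

lemma integrable_profile [simp]:
  fixes f :: "('a \<Rightarrow> nat) \<Rightarrow> real"
  shows "integrable (measure_pmf (profile_dist I)) f"
  unfolding profile
  by (intro integrable_measure_pmf_finite finite_set_Pi_pmf fin_actions fin_p)

lemma actions_taken_subset:
  assumes "\<pi> \<in> strategies I" "x \<in> set_pmf (profile_dist I)"
  shows "actions_taken I \<pi> x \<subseteq> actions I"
  using final_history_halts(1)[OF valid assms] by (auto simp: histories_def actions_taken_def)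

definition take_prob :: "'a strategy \<Rightarrow> 'a \<Rightarrow> real" where
  "take_prob \<pi> i = measure_pmf.prob (profile_dist I) {x. i \<in> actions_taken I \<pi> x}"

lemma take_prob_bounds: "0 \<le> take_prob \<pi> i" "take_prob \<pi> i \<le> 1"
  by (auto simp: take_prob_def)

text \<open>
  A Wald identity: the decision to take \<open>i\<close> is made before, hence independently of, its outcome.
\<close>

lemma expectation_sum_actions_taken:
  fixes f :: "'a \<Rightarrow> nat \<Rightarrow> real"
  assumes \<pi>: "\<pi> \<in> strategies I"
  shows "measure_pmf.expectation (profile_dist I) (\<lambda>x. \<Sum>i\<in>actions_taken I \<pi> x. f i (x i)) =
           (\<Sum>i\<in>actions I. take_prob \<pi> i * measure_pmf.expectation (p i) (f i))"
proof -
  let ?E = "measure_pmf.expectation (profile_dist I)"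
  let ?g = "\<lambda>i. indicator {x. i \<in> actions_taken I \<pi> x} :: _ \<Rightarrow> real"
  have "?E (\<lambda>x. \<Sum>i\<in>actions_taken I \<pi> x. f i (x i)) =
          ?E (\<lambda>x. \<Sum>i\<in>actions I. f i (x i) * ?g i x)"
  proof (intro integral_cong_AE AE_pmfI)
    fix x assume "x \<in> set_pmf (profile_dist I)"
    from actions_taken_subset[OF \<pi> this]
    show "(\<Sum>i\<in>actions_taken I \<pi> x. f i (x i)) = (\<Sum>i\<in>actions I. f i (x i) * ?g i x)"
      using fin_actions by (intro sum.mono_neutral_cong_left) auto
  qed auto
  also have "\<dots> = (\<Sum>i\<in>actions I. ?E (\<lambda>x. f i (x i) * ?g i x))"
    by (intro Bochner_Integration.integral_sum integrable_profile)
  also have "\<dots> = (\<Sum>i\<in>actions I. take_prob \<pi> i * measure_pmf.expectation (p i) (f i))"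
  proof (intro sum.cong refl)
    fix i assume i: "i \<in> actions I"
    have "?E (\<lambda>x. f i (x i) * ?g i x) = measure_pmf.expectation (p i) (f i) * ?E (?g i)"
      unfolding profile
      by (rule expectation_Pi_pmf_mult_component[OF fin_actions i fin_p])
         (simp_all add: indicator_def actions_taken_update)
    then show "?E (\<lambda>x. f i (x i) * ?g i x) =
                 take_prob \<pi> i * measure_pmf.expectation (p i) (f i)"
      by (simp add: take_prob_def)
  qed
  finally show ?thesis .
qed

text \<open>A pathwise union bound: a final outcome other than 1 was revealed by some taken action,
  so its value is one of the nonnegative summands. The always revealed outcome 1 is covered by
  \<open>f 1 = 0\<close>.\<close>

lemma le_sum_actions_taken:
  fixes f :: "nat \<Rightarrow> real"
  assumes \<pi>: "\<pi> \<in> strategies I" and x: "x \<in> set_pmf (profile_dist I)"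
    and f: "f 1 = 0" "\<And>j. j \<in> outcomes I \<Longrightarrow> 0 \<le> f j"
  shows "f (final_outcome I \<pi> x) \<le> (\<Sum>i\<in>actions_taken I \<pi> x. f (x i))"
proof -
  note h = final_history_halts[OF valid \<pi> x]
  have nonneg: "0 \<le> f (x i)" if "i \<in> actions_taken I \<pi> x" for i
    using that actions_taken_subset[OF \<pi> x] valid x f(2) by (auto simp: valid_instance_def)
  have fin: "finite (actions_taken I \<pi> x)" by (simp add: actions_taken_def)
  show ?thesis
  proof (cases "final_outcome I \<pi> x = 1")
    case True
    then show ?thesis using nonneg f(1) by (simp add: sum_nonneg)
  next
    case False
    with h(3) obtain i where "(i, final_outcome I \<pi> x) \<in> set (final_history I \<pi> x)" by auto
    then have "i \<in> actions_taken I \<pi> x" "final_outcome I \<pi> x = x i"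
      using final_history_outcome by (force simp: actions_taken_def)+
    then show ?thesis using fin nonneg by (auto intro: member_le_sum)
  qed
qed

text \<open>Crediting the agent with the payments of all revealed outcomes, not just the selected
  one, only increases his utility; the Wald identity then decouples the actions.\<close>

lemma agent_utility_le:
  assumes \<pi>: "\<pi> \<in> strategies I" and t: "t 1 = 0" "\<And>j. j \<in> outcomes I \<Longrightarrow> 0 \<le> t j"
  shows "agent_utility I t \<pi> \<le>
           (\<Sum>i\<in>actions I. take_prob \<pi> i * (measure_pmf.expectation (p i) t - cost I i))"
proof -
  have "agent_utility I t \<pi> \<le> measure_pmf.expectation (profile_dist I)
          (\<lambda>x. \<Sum>i\<in>actions_taken I \<pi> x. t (x i) - cost I i)"
    unfolding agent_utility_def
    using le_sum_actions_taken[where f = t, OF \<pi> _ t]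
    by (intro integral_mono_AE AE_pmfI) (auto simp: sum_subtractf)
  also have "\<dots> = (\<Sum>i\<in>actions I. take_prob \<pi> i *
                      measure_pmf.expectation (p i) (\<lambda>j. t j - cost I i))"
    by (rule expectation_sum_actions_taken[OF \<pi>])
  also have "\<dots> = (\<Sum>i\<in>actions I. take_prob \<pi> i * (measure_pmf.expectation (p i) t - cost I i))"
    using fin_p by (intro sum.cong refl) (simp add: integrable_measure_pmf_finite)
  finally show ?thesis .
qed

lemma expectation_final_outcome_le:
  assumes \<pi>: "\<pi> \<in> strategies I" and f: "f 1 = 0" "\<And>j. j \<in> outcomes I \<Longrightarrow> 0 \<le> f j"
  shows "measure_pmf.expectation (profile_dist I) (\<lambda>x. f (final_outcome I \<pi> x)) \<le>
           (\<Sum>i\<in>actions I. take_prob \<pi> i * measure_pmf.expectation (p i) f)"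
  unfolding expectation_sum_actions_taken[OF \<pi>, symmetric]
  using le_sum_actions_taken[where f = f, OF \<pi> _ f] by (intro integral_mono_AE AE_pmfI) auto

end

section \<open>Searching through the first actions until a success\<close>

text \<open>A strategy must decide on all of \<open>histories I\<close>, including those this search
  never reaches. The test that \<open>h\<close> lists the actions \<open>0, 1, ...\<close> in order
  makes \<open>length h\<close> a fresh action; otherwise the last outcome is a permitted
  choice.\<close>

definition search :: "nat contract_instance \<Rightarrow> nat \<Rightarrow> nat strategy" where
  "search I k = restrict
     (\<lambda>h. if map fst h = [0..<length h] \<and> snd ` set h \<subseteq> {1} \<and> length h < k
          then Take (length h) else Halt (if h = [] then 1 else snd (last h)))
     (histories I)"

locale nat_product_instance = product_instance I d p
  for I :: "nat contract_instance" and d p +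
  fixes n :: nat
  assumes actions: "actions I = {..<n}"
begin

lemma search_in_strategies:
  assumes k: "k \<le> n"
  shows "search I k \<in> strategies I"
  unfolding strategies_def
proof (rule PiE_I)
  fix h assume h: "h \<in> histories I"
  show "search I k h \<in> decisions I h"
  proof (cases "map fst h = [0..<length h] \<and> snd ` set h \<subseteq> {1} \<and> length h < k")
    case True
    then have "fst ` set h = {..<length h}"
      by (metis atLeast_upt list.set_map)
    with True h k show ?thesis by (auto simp: search_def decisions_def actions)
  next
    case False
    with h show ?thesis by (auto simp: search_def decisions_def)
  qed
qed (simp add: search_def)

lemma search_initial:
  assumes "map (\<lambda>i. (i, x i)) [0..<j] \<in> histories I"
  shows "search I k (map (\<lambda>i. (i, x i)) [0..<j]) =
           (if (\<forall>i<j. x i = 1) \<and> j < k then Take j else Halt (if j = 0 then 1 else x (j - 1)))"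
  using assms by (auto simp: search_def comp_def image_subset_iff last_map)

text \<open>Every history of the run is an initial segment in which only the last outcome can differ
  from 1; hence the bound \<open>j - 1\<close>, which truncates to 0 for the empty history.\<close>

lemma final_history_search:
  assumes k: "k \<le> n" and x: "x \<in> set_pmf (profile_dist I)"
  obtains j where "j \<le> k" "final_history I (search I k) x = map (\<lambda>i. (i, x i)) [0..<j]"
    "\<forall>i<j - 1. x i = 1" "j = k \<or> (\<exists>i<j. x i \<noteq> 1)"
    "final_outcome I (search I k) x = (if j = 0 then 1 else x (j - 1))"
proof -
  define H where "H m = (step (search I k) x ^^ m) []" for m
  have "\<exists>j\<le>k. H m = map (\<lambda>i. (i, x i)) [0..<j] \<and> (\<forall>i<j - 1. x i = 1)" for m
  proof (induction m)
    case 0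
    then show ?case by (simp add: H_def)
  next
    case (Suc m)
    then obtain j where j: "j \<le> k" "H m = map (\<lambda>i. (i, x i)) [0..<j]" "\<forall>i<j - 1. x i = 1"
      by blast
    have S: "H (Suc m) = step (search I k) x (H m)" by (simp add: H_def)
    have "x i \<in> outcomes I" if "i < n" for i
      using valid x that by (auto simp: valid_instance_def actions)
    then have h: "H m \<in> histories I"
      using j k by (auto simp: histories_def actions comp_def)
    show ?case
    proof (cases "(\<forall>i<j. x i = 1) \<and> j < k")
      case True
      then have "search I k (H m) = Take j"
        using search_initial[of x j k] h unfolding j(2) by simp
      then have "H (Suc m) = map (\<lambda>i. (i, x i)) [0..<Suc j]"
        by (simp add: S step_def j(2))
      with True show ?thesis by (intro exI[of _ "Suc j"]) auto
    next
      case False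
      then have "search I k (H m) = Halt (if j = 0 then 1 else x (j - 1))"
        using search_initial[of x j k] h by (simp only: j(2) if_False)
      then have "H (Suc m) = H m" by (simp add: S step_def)
      with j show ?thesis by auto
    qed
  qed
  then obtain j where j: "j \<le> k"
      "final_history I (search I k) x = map (\<lambda>i. (i, x i)) [0..<j]" "\<forall>i<j - 1. x i = 1"
    unfolding H_def final_history_def by blast
  \<comment> \<open>The invariant does not tell why the run stopped. That the decision at the final
    history is \<open>Halt\<close> excludes the \<open>Take\<close> case of
    \<open>search_initial\<close> and identifies the selected outcome.\<close>
  note h = final_history_halts[OF valid search_in_strategies[OF k] x]
  have "final_outcome I (search I k) x = (if j = 0 then 1 else x (j - 1)) \<and>
        (j = k \<or> (\<exists>i<j. x i \<noteq> 1))"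
    using h(1,2) search_initial[of x j k] j(1) unfolding j(2) by (auto split: if_splits)
  with j that show ?thesis by blast
qed

text \<open>The search sees at most one outcome other than 1, and selects it, so the union bound
  \<open>le_sum_actions_taken\<close> is attained.\<close>

lemma sum_actions_taken_search:
  fixes f :: "nat \<Rightarrow> real"
  assumes k: "k \<le> n" and x: "x \<in> set_pmf (profile_dist I)" and f: "f 1 = 0"
  shows "(\<Sum>i\<in>actions_taken I (search I k) x. f (x i)) = f (final_outcome I (search I k) x)"
proof -
  obtain j where j: "final_history I (search I k) x = map (\<lambda>i. (i, x i)) [0..<j]"
    "\<forall>i<j - 1. x i = 1" "final_outcome I (search I k) x = (if j = 0 then 1 else x (j - 1))"
    using final_history_search[OF k x] by metis
  have S: "actions_taken I (search I k) x = {..<j}"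
    by (auto simp: actions_taken_def j(1) image_image)
  show ?thesis
  proof (cases j)
    case 0
    then show ?thesis using S j(3) f by simp
  next
    case (Suc l)
    then show ?thesis using S j f by simp
  qed
qed

lemma expectation_final_outcome_search:
  assumes k: "k \<le> n" and f: "f 1 = 0"
  shows "measure_pmf.expectation (profile_dist I) (\<lambda>x. f (final_outcome I (search I k) x)) =
           (\<Sum>i<n. take_prob (search I k) i * measure_pmf.expectation (p i) f)"
  unfolding expectation_sum_actions_taken[OF search_in_strategies[OF k], unfolded actions, symmetric]
  using sum_actions_taken_search[where f = f, OF k _ f] by (intro integral_cong_AE AE_pmfI) auto

lemma agent_utility_search:
  assumes k: "k \<le> n" and t: "t 1 = 0"
  shows "agent_utility I t (search I k) =
           (\<Sum>i<n. take_prob (search I k) i * (measure_pmf.expectation (p i) t - cost I i))"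
proof -
  have "agent_utility I t (search I k) = measure_pmf.expectation (profile_dist I)
          (\<lambda>x. \<Sum>i\<in>actions_taken I (search I k) x. t (x i) - cost I i)"
    unfolding agent_utility_def
    using sum_actions_taken_search[where f = t, OF k _ t]
    by (intro integral_cong_AE AE_pmfI) (auto simp: sum_subtractf)
  also have "\<dots> = (\<Sum>i<n. take_prob (search I k) i *
                      measure_pmf.expectation (p i) (\<lambda>j. t j - cost I i))"
    using expectation_sum_actions_taken[OF search_in_strategies[OF k], of "\<lambda>i j. t j - cost I i"]
    by (simp only: actions)
  also have "\<dots> = (\<Sum>i<n. take_prob (search I k) i *
                      (measure_pmf.expectation (p i) t - cost I i))"
    using fin_p by (intro sum.cong refl) (simp add: integrable_measure_pmf_finite actions)
  finally show ?thesis .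
qed

lemma take_prob_search_outside:
  assumes k: "k \<le> n" and i: "k \<le> i"
  shows "take_prob (search I k) i = 0"
proof -
  have "i \<notin> actions_taken I (search I k) x" if "x \<in> set_pmf (profile_dist I)" for x
    by (rule final_history_search[OF k that]) (use i in \<open>auto simp: actions_taken_def\<close>)
  then show ?thesis by (auto simp: take_prob_def measure_pmf_zero_iff)
qed

text \<open>If all outcomes are 1, the search never stops early. The product runs over all
  \<open>n\<close> actions, not just the first \<open>k\<close>, to make the bound uniform in
  \<open>k\<close>.\<close>

lemma take_prob_search_ge:
  assumes k: "k \<le> n" and i: "i < k"
  shows "take_prob (search I k) i \<ge> (\<Prod>j<n. pmf (p j) 1)"
proof -
  have "(\<Prod>j<n. pmf (p j) 1) = measure_pmf.prob (profile_dist I) (Pi {..<n} (\<lambda>_. {1}))"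
    by (simp add: profile actions measure_Pi_pmf_Pi measure_pmf_single)
  also have "\<dots> \<le> take_prob (search I k) i"
    unfolding take_prob_def
  proof (rule measure_pmf.finite_measure_mono_AE)
    show "AE x in measure_pmf (profile_dist I).
            x \<in> Pi {..<n} (\<lambda>_. {1}) \<longrightarrow> x \<in> {x. i \<in> actions_taken I (search I k) x}"
    proof (intro AE_pmfI impI)
      fix x assume x: "x \<in> set_pmf (profile_dist I)" and one: "x \<in> Pi {..<n} (\<lambda>_. {1})"
      obtain j where j: "j \<le> k" "final_history I (search I k) x = map (\<lambda>i. (i, x i)) [0..<j]"
          "j = k \<or> (\<exists>i<j. x i \<noteq> 1)"
        using final_history_search[OF k x] by metis
      have "j = k" using j one k by (auto simp: Pi_def)
      then show "x \<in> {x. i \<in> actions_taken I (search I k) x}"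
        using i by (auto simp: actions_taken_def j(2) image_image)
    qed
  qed simp
  finally show ?thesis .
qed

end


section \<open>The instance with the gap\<close>

text \<open>By a union bound, \<open>gap_scale n * 2 ^ n\<close> bounds the probability that any
  action succeeds. The choice keeps even \<open>n\<close> times this quantity below 1/2, which
  absorbs the total error in the estimate for linear contracts.\<close>

definition gap_scale :: "nat \<Rightarrow> real" where
  "gap_scale n = 1 / (2 * 4 ^ n)"

definition gap_outcome :: "nat \<Rightarrow> nat \<Rightarrow> nat pmf" where
  "gap_outcome n i = pmf_of_list
     [(1, 1 - gap_scale n * 2 ^ i), (2, gap_scale n), (3, gap_scale n * (2 ^ i - 1))]"

definition gap_instance :: "nat \<Rightarrow> nat contract_instance" where
  "gap_instance n = \<lparr>actions = {..<n}, num_outcomes = 3,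
     cost = (\<lambda>i. gap_scale n * (2 ^ i - 1)), reward = (\<lambda>j. if j = 1 then 0 else 1),
     profile_dist = Pi_pmf {..<n} 1 (gap_outcome n)\<rparr>"

lemma gap_scale_pos: "0 < gap_scale n"
  by (simp add: gap_scale_def)

lemma gap_scale_bounds: "gap_scale n * 2 ^ n \<le> 1 / 2" "real n * (gap_scale n * 2 ^ n) \<le> 1 / 2"
proof -
  have *: "gap_scale n * 2 ^ n = 1 / (2 * 2 ^ n)"
    by (simp add: gap_scale_def field_simps flip: power_mult_distrib)
  show "gap_scale n * 2 ^ n \<le> 1 / 2" by (simp add: * field_simps)
  have "real n \<le> 2 ^ n" using of_nat_less_two_power[of n] by (simp add: less_imp_le)
  then show "real n * (gap_scale n * 2 ^ n) \<le> 1 / 2" by (simp add: * field_simps)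
qed

lemma gap_outcome_wf:
  assumes "i < n"
  shows "pmf_of_list_wf
     [(1 :: nat, 1 - gap_scale n * 2 ^ i), (2, gap_scale n), (3, gap_scale n * (2 ^ i - 1))]"
proof -
  have "gap_scale n * 2 ^ i \<le> gap_scale n * 2 ^ n"
    using assms gap_scale_pos[of n] by (intro mult_left_mono power_increasing) auto
  then have "gap_scale n * 2 ^ i \<le> 1" using gap_scale_bounds(1)[of n] by simp
  moreover have "0 \<le> gap_scale n * (2 ^ i - 1)" using gap_scale_pos[of n] by simp
  ultimately show ?thesis
    using gap_scale_pos[of n] by (intro pmf_of_list_wfI) (auto simp: right_diff_distrib)
qed

lemma set_gap_outcome:
  assumes "i < n"
  shows "set_pmf (gap_outcome n i) \<subseteq> {1, 2, 3}"
  using set_pmf_of_list[OF gap_outcome_wf[OF assms]] by (auto simp: gap_outcome_def)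

lemma pmf_gap_outcome_1: "i < n \<Longrightarrow> pmf (gap_outcome n i) 1 = 1 - gap_scale n * 2 ^ i"
  by (simp add: gap_outcome_def pmf_pmf_of_list[OF gap_outcome_wf] del: One_nat_def)

lemma expectation_gap_outcome:
  assumes i: "i < n" and f: "f 1 = 0"
  shows "measure_pmf.expectation (gap_outcome n i) f =
           gap_scale n * f 2 + gap_scale n * (2 ^ i - 1) * f 3"
proof -
  have "measure_pmf.expectation (gap_outcome n i) f =
          (\<Sum>j\<in>{1, 2, 3}. f j * pmf (gap_outcome n i) j)"
    using set_gap_outcome[OF i] by (intro integral_measure_pmf_real) auto
  also have "\<dots> = gap_scale n * f 2 + gap_scale n * (2 ^ i - 1) * f 3"
    using f by (simp add: gap_outcome_def pmf_pmf_of_list[OF gap_outcome_wf[OF i]] del: One_nat_def)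
  finally show ?thesis .
qed

lemma valid_gap_instance: "valid_instance (gap_instance n)"
proof -
  have "x i \<in> {1..3}" if "x \<in> set_pmf (Pi_pmf {..<n} 1 (gap_outcome n))" "i < n" for x i
    using that set_gap_outcome[of i n] by (auto simp: set_Pi_pmf PiE_dflt_def)
  then show ?thesis
    using gap_scale_pos[of n]
    by (auto simp: valid_instance_def gap_instance_def outcomes_def mono_on_def)
qed

lemma independent_gap_instance: "independent_actions (gap_instance n)"
  by (simp add: independent_actions_def gap_instance_def indep_vars_Pi_pmf)

interpretation gap: nat_product_instance "gap_instance n" 1 "gap_outcome n" n for n
proof unfold_locales
  show "finite (set_pmf (gap_outcome n i))" if "i \<in> actions (gap_instance n)" for i
    using that finite_subset[OF set_gap_outcome[of i n]] by (simp add: gap_instance_def)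
qed (rule valid_gap_instance, simp_all add: gap_instance_def)

text \<open>The Weierstrass product inequality: each new factor lowers the product by
  \<open>s a\<close> times a product that is at most 1.\<close>

lemma prod_one_minus_ge:
  fixes s :: "'a \<Rightarrow> real"
  assumes "finite A" "\<And>i. i \<in> A \<Longrightarrow> 0 \<le> s i \<and> s i \<le> 1"
  shows "1 - sum s A \<le> (\<Prod>i\<in>A. 1 - s i)"
  using assms
proof (induction A rule: finite_induct)
  case (insert a A)
  then have "(\<Prod>i\<in>A. 1 - s i) \<le> 1" by (intro prod_le_1) auto
  then have "s a * (\<Prod>i\<in>A. 1 - s i) \<le> s a"
    using insert.prems by (simp add: mult_left_le)
  with insert show ?case by (simp add: algebra_simps)
qed simp

lemma gap_take_prob_search_ge:
  assumes "k \<le> n" "i < k"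
  shows "gap.take_prob n (search (gap_instance n) k) i \<ge> 1 - gap_scale n * 2 ^ n"
proof -
  have s: "gap_scale n * 2 ^ j \<le> 1" if "j < n" for j
    using gap_outcome_wf[OF that] by (simp add: pmf_of_list_wf_def)
  have "(\<Sum>j<n. gap_scale n * 2 ^ j) = gap_scale n * (2 ^ n - 1)"
    by (simp add: sum_gp_strict flip: sum_distrib_left)
  then have "1 - gap_scale n * 2 ^ n \<le> 1 - (\<Sum>j<n. gap_scale n * 2 ^ j)"
    using gap_scale_pos[of n] by (simp add: algebra_simps)
  also have "\<dots> \<le> (\<Prod>j<n. 1 - gap_scale n * 2 ^ j)"
    using s gap_scale_pos[of n] by (intro prod_one_minus_ge) auto
  also have "\<dots> = (\<Prod>j<n. pmf (gap_outcome n j) 1)"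
    by (intro prod.cong) (simp_all add: pmf_gap_outcome_1 del: One_nat_def)
  also have "\<dots> \<le> gap.take_prob n (search (gap_instance n) k) i"
    by (rule gap.take_prob_search_ge[OF assms])
  finally show ?thesis .
qed

section \<open>Comparing the best response with other strategies\<close>

lemma best_response_agent_utility:
  assumes "valid_instance I" "linear_order_on (strategies I) R" "\<sigma> \<in> strategies I"
  shows "agent_utility I t \<sigma> \<le> agent_utility I t (best_response I R t)"
  using best_response_in(1)[OF assms(1,2), of t] assms(3)
  by (auto simp: principal_preferred_def agent_optimal_def is_arg_max_def not_less)

text \<open>Ties go to the principal, so any single agent-optimal strategy bounds the value of the
  contract from below.\<close>

lemma principal_utility_le_principal_value:
  assumes "valid_instance I" "linear_order_on (strategies I) R" "\<sigma> \<in> strategies I"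
    and "\<And>\<pi>. \<pi> \<in> strategies I \<Longrightarrow> agent_utility I t \<pi> \<le> agent_utility I t \<sigma>"
  shows "principal_utility I t \<sigma> \<le> principal_value I R t"
proof -
  have "\<sigma> \<in> agent_optimal I t"
    using assms(3,4) by (auto simp: agent_optimal_def is_arg_max_def not_less)
  then show ?thesis
    using best_response_in(1)[OF assms(1,2), of t]
    by (auto simp: principal_value_def principal_preferred_def is_arg_max_def not_less)
qed

section \<open>A good general contract\<close>

text \<open>Each action's expected payment equals its cost, so no strategy has positive utility and
  the full search, with utility 0, is agent-optimal. In it each action brings the principal
  \<open>gap_scale n\<close> times its probability of being taken, which is at least 1/2.\<close>

lemma gap_principal_value_general:
  assumes R: "linear_order_on (strategies (gap_instance n)) R"
  shows "real n * gap_scale n / 2 \<le>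
           principal_value (gap_instance n) R (\<lambda>j. if j = 3 then 1 else 0)"
proof -
  let ?I = "gap_instance n" and ?t = "\<lambda>j::nat. if j = 3 then 1 else 0 :: real"
  let ?\<sigma> = "search ?I n"
  let ?f = "\<lambda>j. reward ?I j - ?t j"
  have E: "measure_pmf.expectation (gap_outcome n i) ?t - cost ?I i = 0" if "i < n" for i
    using that by (subst expectation_gap_outcome) (auto simp: gap_instance_def)
  have "agent_utility ?I ?t \<pi> \<le> 0" if "\<pi> \<in> strategies ?I" for \<pi>
    using gap.agent_utility_le[of \<pi> n ?t, OF that] E by (simp add: gap.actions)
  moreover have "agent_utility ?I ?t ?\<sigma> = 0"
    using gap.agent_utility_search[of n n ?t] E by simp
  ultimately have "principal_utility ?I ?t ?\<sigma> \<le> principal_value ?I R ?t"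
    by (intro principal_utility_le_principal_value valid_gap_instance R
          gap.search_in_strategies) auto
  moreover have "principal_utility ?I ?t ?\<sigma> =
      (\<Sum>i<n. gap.take_prob n ?\<sigma> i * measure_pmf.expectation (gap_outcome n i) ?f)"
    unfolding principal_utility_def
    by (rule gap.expectation_final_outcome_search) (simp_all add: gap_instance_def)
  moreover have "(\<Sum>i<n. 1 / 2 * gap_scale n) \<le>
      (\<Sum>i<n. gap.take_prob n ?\<sigma> i * measure_pmf.expectation (gap_outcome n i) ?f)"
  proof (intro sum_mono)
    fix i assume "i \<in> {..<n}"
    then have i: "i < n" by simp
    have "measure_pmf.expectation (gap_outcome n i) ?f = gap_scale n"
      using i by (subst expectation_gap_outcome) (auto simp: gap_instance_def)
    moreover have "1 / 2 \<le> gap.take_prob n ?\<sigma> i"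
      using gap_take_prob_search_ge[OF order.refl i] gap_scale_bounds(1)[of n] by simp
    ultimately show "1 / 2 * gap_scale n \<le>
        gap.take_prob n ?\<sigma> i * measure_pmf.expectation (gap_outcome n i) ?f"
      using gap_scale_pos[of n] by (simp only: mult_right_mono less_imp_le)
  qed
  ultimately show ?thesis by simp
qed

section \<open>Upper bound for linear contracts\<close>

text \<open>The bound \<open>z * 2 ^ n\<close> carries the induction: an added term
  \<open>z * 2 ^ n\<close> at most doubles it, and since that term is below 2 the result stays below
  4.\<close>

lemma sum_truncated_powers_le:
  fixes z :: real
  assumes "0 \<le> z"
  shows "(\<Sum>i<n. if z * 2 ^ i < 2 then z * 2 ^ i else 0) \<le> min 4 (z * 2 ^ n)"
  using assms by (induction n) (auto simp: min_def split: if_splits)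

text \<open>As \<open>g\<close> decreases, the actions worth taking form an initial segment, which
  is what \<open>search I k\<close> explores.\<close>

lemma threshold_index:
  fixes g :: "nat \<Rightarrow> real"
  assumes "antimono g"
  obtains k where "k \<le> n" "\<And>i. i < k \<Longrightarrow> 0 \<le> g i" "\<And>i. k \<le> i \<Longrightarrow> i < n \<Longrightarrow> g i < 0"
proof (cases "\<exists>i<n. g i < 0")
  case True
  define k where "k = (LEAST i. g i < 0)"
  have "g k < 0" "k \<le> n" unfolding k_def
    using True by (auto intro: LeastI less_imp_le le_less_trans[OF Least_le])
  moreover have "0 \<le> g i" if "i < k" for i
    using not_less_Least[of i "\<lambda>i. g i < 0"] that by (auto simp: k_def)
  moreover have "g i < 0" if "k \<le> i" for i
    using antimonoD[OF assms that] \<open>g k < 0\<close> by simp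
  ultimately show ?thesis using that by blast
next
  case False
  then have "0 \<le> g i" if "i < n" for i using that by (meson not_less)
  then show ?thesis using that[of n] by auto
qed

text \<open>A linear programming argument: the principal gets at most the sum of
  \<open>y i * u i\<close> with every \<open>y i\<close> between 0 and 1, and the optimality of the
  agent enters through the single constraint \<open>near\<close>.\<close>

lemma gap_principal_value_linear:
  assumes R: "linear_order_on (strategies (gap_instance n)) R" and \<alpha>: "\<alpha> \<in> {0..1}"
  shows "principal_value (gap_instance n) R (linear_contract (gap_instance n) \<alpha>) \<le>
           5 * gap_scale n"
proof -
  let ?I = "gap_instance n"
  let ?t = "linear_contract ?I \<alpha>"
  define e where "e = gap_scale n"
  define \<eta> where "\<eta> = e * 2 ^ n"
  define \<pi> where "\<pi> = best_response ?I R ?t"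
  define y where "y = gap.take_prob n \<pi>"
  define u where "u i = (1 - \<alpha>) * (e * 2 ^ i)" for i :: nat
  define g where "g i = e - u i" for i
  have e: "0 < e" "0 \<le> \<eta>" "\<eta> \<le> 1" "real n * \<eta> \<le> 1 / 2"
    using gap_scale_pos[of n] gap_scale_bounds[of n] by (auto simp: e_def \<eta>_def)
  have u: "0 \<le> u i" for i using \<alpha> e by (simp add: u_def)
  have \<pi>: "\<pi> \<in> strategies ?I"
    unfolding \<pi>_def by (rule best_response_in(2)[OF valid_gap_instance R])
  have y: "0 \<le> y i" "y i \<le> 1" for i by (simp_all add: y_def gap.take_prob_bounds)
  have t1: "?t 1 = 0" and t0: "\<And>j. 0 \<le> ?t j"
    using \<alpha> by (auto simp: linear_contract_def gap_instance_def)
  have E: "measure_pmf.expectation (gap_outcome n i) ?t - cost ?I i = g i" if "i < n" for i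
    using t1 by (subst expectation_gap_outcome[OF that])
      (auto simp: linear_contract_def gap_instance_def g_def u_def e_def algebra_simps)
  have Er: "measure_pmf.expectation (gap_outcome n i) (reward ?I) = e * 2 ^ i" if "i < n" for i
    by (subst expectation_gap_outcome[OF that])
      (auto simp: gap_instance_def e_def algebra_simps)
  have "antimono g"
    unfolding antimono_def g_def u_def using \<alpha> e
    by (auto intro!: mult_left_mono power_increasing)
  then obtain k where k: "k \<le> n" "\<And>i. i < k \<Longrightarrow> 0 \<le> g i"
      "\<And>i. k \<le> i \<Longrightarrow> i < n \<Longrightarrow> g i < 0"
    using threshold_index by blast
  \<comment> \<open>Below \<open>k\<close> the search takes each action with probability at least
    \<open>1 - \<eta>\<close>; from \<open>k\<close> on both sides vanish.\<close>
  have "(1 - \<eta>) * (\<Sum>i<n. max 0 (g i)) \<le>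
          (\<Sum>i<n. gap.take_prob n (search ?I k) i * g i)"
    unfolding sum_distrib_left
  proof (intro sum_mono)
    fix i assume "i \<in> {..<n}"
    then show "(1 - \<eta>) * max 0 (g i) \<le> gap.take_prob n (search ?I k) i * g i"
      using k gap_take_prob_search_ge[OF k(1), of i] gap.take_prob_search_outside[OF k(1), of i]
      by (cases "i < k") (auto simp: \<eta>_def e_def max_absorb1 less_imp_le intro!: mult_right_mono)
  qed
  also have "\<dots> = agent_utility ?I ?t (search ?I k)"
    using gap.agent_utility_search[where t = ?t, OF k(1) t1] E by simp
  also have "\<dots> \<le> agent_utility ?I ?t \<pi>"
    unfolding \<pi>_def
    by (intro best_response_agent_utility valid_gap_instance R gap.search_in_strategies k)
  also have "\<dots> \<le> (\<Sum>i<n. y i * g i)"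
    using gap.agent_utility_le[where t = ?t, OF \<pi> t1 t0] E by (simp add: gap.actions y_def)
  finally have near: "(1 - \<eta>) * (\<Sum>i<n. max 0 (g i)) \<le> (\<Sum>i<n. y i * g i)" .

  have "principal_value ?I R ?t =
          (1 - \<alpha>) * measure_pmf.expectation (profile_dist ?I) (\<lambda>x. reward ?I (final_outcome ?I \<pi> x))"
    by (simp add: principal_value_def principal_utility_def linear_contract_def \<pi>_def
          left_diff_distrib)
  also have "\<dots> \<le> (1 - \<alpha>) * (\<Sum>i<n. y i * (e * 2 ^ i))"
    using \<alpha> gap.expectation_final_outcome_le[where f = "reward ?I", OF \<pi>] Er
    by (intro mult_left_mono) (auto simp: gap.actions y_def gap_instance_def)
  \<comment> \<open>Weighing \<open>near\<close> with multiplier 2 cancels the contribution of every action with \<open>u i \<ge> 2 * e\<close>.\<close>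
  also have "\<dots> = (\<Sum>i<n. y i * (e + g i)) - 2 * (\<Sum>i<n. y i * g i)"
    by (simp add: g_def u_def sum_distrib_left algebra_simps flip: sum_subtractf sum.distrib)
  also have "\<dots> \<le> (\<Sum>i<n. max 0 (e + g i)) - 2 * ((1 - \<eta>) * (\<Sum>i<n. max 0 (g i)))"
  proof -
    have "y i * (e + g i) \<le> max 0 (e + g i)" for i
      using y[of i] by (cases "0 \<le> e + g i") (auto simp: mult_left_le_one_le mult_le_0_iff)
    then show ?thesis using near by (intro diff_mono sum_mono mult_left_mono) auto
  qed
  also have "\<dots> = (\<Sum>i<n. max 0 (e + g i) - 2 * max 0 (g i)) + 2 * \<eta> * (\<Sum>i<n. max 0 (g i))"
    by (simp add: sum_subtractf sum_distrib_left algebra_simps)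
  \<comment> \<open>Here \<open>e + g i = 2 * e - u i\<close>. The difference of maxima is
    \<open>u i\<close> if \<open>u i \<le> e\<close>, it is \<open>2 * e - u i \<le> u i\<close> if
    \<open>u i\<close> lies between \<open>e\<close> and \<open>2 * e\<close>, and it is 0
    beyond.\<close>
  also have "\<dots> \<le> (\<Sum>i<n. e * (if (1 - \<alpha>) * 2 ^ i < 2 then (1 - \<alpha>) * 2 ^ i else 0)) +
                    2 * \<eta> * (\<Sum>i<n. e)"
  proof (intro add_mono sum_mono mult_left_mono)
    fix i
    have u_eq: "u i = e * ((1 - \<alpha>) * 2 ^ i)" by (simp add: u_def)
    have "(1 - \<alpha>) * 2 ^ i < 2 \<longleftrightarrow> u i < 2 * e"
      unfolding u_eq using e by (simp add: mult.commute)
    then show "max 0 (e + g i) - 2 * max 0 (g i) \<le>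
            e * (if (1 - \<alpha>) * 2 ^ i < 2 then (1 - \<alpha>) * 2 ^ i else 0)"
      using u[of i] by (auto simp: g_def u_eq[symmetric] max_def)
    show "max 0 (g i) \<le> e" using u[of i] e by (simp add: g_def)
  qed (use e in auto)
  \<comment> \<open>The 4 is the truncated geometric sum with \<open>z = 1 - \<alpha>\<close>; the 1
    comes from \<open>real n * \<eta> \<le> 1 / 2\<close>.\<close>
  also have "\<dots> \<le> e * 4 + e * 1"
  proof (intro add_mono)
    show "(\<Sum>i<n. e * (if (1 - \<alpha>) * 2 ^ i < 2 then (1 - \<alpha>) * 2 ^ i else 0)) \<le> e * 4"
      using sum_truncated_powers_le[of "1 - \<alpha>" n] \<alpha> e
      by (auto simp flip: sum_distrib_left intro!: mult_left_mono)
    have "2 * \<eta> * (\<Sum>i<n. e) = e * (2 * (real n * \<eta>))" by simp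
    also have "\<dots> \<le> e * 1" using e by (intro mult_left_mono) auto
    finally show "2 * \<eta> * (\<Sum>i<n. e) \<le> e * 1" .
  qed
  finally show ?thesis by (simp add: e_def)
qed

text \<open>This makes the denominator of the ratio positive. Action 0 is free and yields outcome 2
  with probability \<open>gap_scale n\<close>, so even without payment the agent is willing to take
  it and ties favour the principal.\<close>

lemma gap_principal_value_zero:
  assumes R: "linear_order_on (strategies (gap_instance n)) R" and n: "0 < n"
  shows "0 < principal_value (gap_instance n) R (linear_contract (gap_instance n) 0)"
proof -
  let ?I = "gap_instance n" and ?t = "linear_contract (gap_instance n) 0"
  let ?\<sigma> = "search ?I 1"
  have k: "1 \<le> n" using n by simp
  have t: "?t = (\<lambda>_. 0)" by (simp add: linear_contract_def)
  have c: "0 \<le> cost ?I i" "cost ?I 0 = 0" for i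
    using gap_scale_pos[of n] by (auto simp: gap_instance_def)
  have y: "gap.take_prob n ?\<sigma> i = 0" if "1 \<le> i" for i
    using gap.take_prob_search_outside[OF k that] .
  have y0: "1 / 2 \<le> gap.take_prob n ?\<sigma> 0"
    using gap_take_prob_search_ge[OF k, of 0] gap_scale_bounds(1)[of n] by simp
  have "agent_utility ?I ?t \<pi> \<le> 0" for \<pi>
    unfolding agent_utility_def t
    using c(1) by (simp add: sum_nonneg)
  moreover have "agent_utility ?I ?t ?\<sigma> = 0"
    unfolding t gap.agent_utility_search[OF k, where t = "\<lambda>_. 0", OF refl]
  proof (intro sum.neutral ballI)
    fix i show "gap.take_prob n ?\<sigma> i *
        (measure_pmf.expectation (gap_outcome n i) (\<lambda>_. 0) - cost ?I i) = 0"
      using y[of i] c(2) by (cases "i = 0") auto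
  qed
  ultimately have "principal_utility ?I ?t ?\<sigma> \<le> principal_value ?I R ?t"
    by (intro principal_utility_le_principal_value valid_gap_instance R
          gap.search_in_strategies k) auto
  moreover have "principal_utility ?I ?t ?\<sigma> =
      (\<Sum>i<n. gap.take_prob n ?\<sigma> i * measure_pmf.expectation (gap_outcome n i) (reward ?I))"
    unfolding principal_utility_def t diff_zero
    by (rule gap.expectation_final_outcome_search[OF k]) (simp add: gap_instance_def)
  moreover have "\<dots> \<ge> gap.take_prob n ?\<sigma> 0 * measure_pmf.expectation (gap_outcome n 0) (reward ?I)"
  proof (rule member_le_sum)
    show "0 \<le> gap.take_prob n ?\<sigma> i * measure_pmf.expectation (gap_outcome n i) (reward ?I)" for i
      by (intro mult_nonneg_nonneg gap.take_prob_bounds integral_nonneg_AE)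
         (auto simp: gap_instance_def)
  qed (use n in auto)
  moreover have "measure_pmf.expectation (gap_outcome n 0) (reward ?I) = gap_scale n"
    using n by (subst expectation_gap_outcome) (auto simp: gap_instance_def)
  moreover have "0 < gap.take_prob n ?\<sigma> 0 * gap_scale n"
    using y0 gap_scale_pos[of n] by (intro mult_pos_pos) auto
  ultimately show ?thesis by simp
qed

section \<open>Comparison of the two suprema\<close>

theorem theoremA1:
  shows "\<exists>C::real. C > 0 \<and> (\<forall>n::nat. \<exists>I::nat contract_instance.
           valid_instance I \<and> independent_actions I \<and>
           card (actions I) = n \<and> num_outcomes I = 3 \<and>
           (\<forall>R. linear_order_on (strategies I) R \<longrightarrow>
              (SUP t\<in>contracts I. principal_value I R t) /
              (SUP \<alpha>\<in>{0..1}. principal_value I R (linear_contract I \<alpha>)) \<ge> C * real n))"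
\<comment> \<open>The constant is the factor 1/2 of the general contract divided by the factor 5 for
  linear contracts.\<close>
proof (intro exI[of _ "1 / 10"] conjI allI)
  fix n :: nat
  let ?I = "gap_instance n"
  have "(SUP t\<in>contracts ?I. principal_value ?I R t) /
          (SUP \<alpha>\<in>{0..1}. principal_value ?I R (linear_contract ?I \<alpha>)) \<ge> 1 / 10 * real n"
    (is "?G / ?L \<ge> _")
    if R: "linear_order_on (strategies ?I) R" for R
  proof -
    let ?v = "principal_value ?I R"
    let ?t = "\<lambda>j::nat. if j = 3 then 1 else 0 :: real"
    have "bdd_above (?v ` contracts ?I)"
      using principal_value_le[OF valid_gap_instance R] by (intro bdd_aboveI2)
    then have "?v ?t \<le> ?G" by (intro cSUP_upper) (auto simp: contracts_def)
    then have G: "real n * gap_scale n / 2 \<le> ?G"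
      using gap_principal_value_general[OF R] by linarith
    have L5: "?L \<le> 5 * gap_scale n"
      using gap_principal_value_linear[OF R] by (intro cSUP_least) auto
    show ?thesis
    \<comment> \<open>For \<open>n = 0\<close> only nonnegativity of the quotient is claimed;
      positivity of the denominator is available for \<open>n > 0\<close> only.\<close>
    proof (cases "n = 0")
      case True
      have "0 \<le> ?v (linear_contract ?I 0)"
        unfolding principal_value_def principal_utility_def linear_contract_def
        by (intro integral_nonneg_AE) (simp add: gap_instance_def)
      also have "\<dots> \<le> ?L"
        using gap_principal_value_linear[OF R]
        by (intro cSUP_upper bdd_aboveI2[where M = "5 * gap_scale n"]) auto
      finally show ?thesis using G True by simp
    next
      case False
      have "0 < ?v (linear_contract ?I 0)"
        using gap_principal_value_zero[OF R] False by simp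
      also have "\<dots> \<le> ?L"
        using gap_principal_value_linear[OF R]
        by (intro cSUP_upper bdd_aboveI2[where M = "5 * gap_scale n"]) auto
      finally have L: "0 < ?L" .
      have "1 / 10 * real n * ?L \<le> 1 / 10 * real n * (5 * gap_scale n)"
        by (intro mult_left_mono L5) auto
      also have "\<dots> \<le> ?G" using G by simp
      finally show ?thesis using L by (simp add: pos_le_divide_eq)
    qed
  qed
  then show "\<exists>I::nat contract_instance.
           valid_instance I \<and> independent_actions I \<and>
           card (actions I) = n \<and> num_outcomes I = 3 \<and>
           (\<forall>R. linear_order_on (strategies I) R \<longrightarrow>
              (SUP t\<in>contracts I. principal_value I R t) /
              (SUP \<alpha>\<in>{0..1}. principal_value I R (linear_contract I \<alpha>)) \<ge> 1 / 10 * real n)"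
    using valid_gap_instance[of n] independent_gap_instance[of n]
    by (intro exI[of _ ?I]) (simp add: gap_instance_def)
qed simp

end
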